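(* Let $G=(V,E)$ be a finite connected undirected graph with $n=|V|$ vertices modelling a wireless sensor network. The worst-case space complexity of the Basic Distributed Greedy Vertex Cover Algorithm run on $G$ is $O(n)$ per node.
   Context: Network model: vertices are identical nodes with unique identifiers, edges are unweighted communication links, each node knows its neighbors, and nodes are time-synchronized and operate in synchronous rounds. Rounds are long enough that all messages sent in a round are delivered (with acknowledgement) within that round. $\Delta$ denotes the maximum degree of $G$, and every node knows $\Delta$. Basic Distributed Greedy Vertex Cover Algorithm: each node keeps a list of its currently active neighbors, its current degree MyDegree (initially its degree in $G$), and a round counter $R$, initially $0$. At the start of each round, every node not already in the cover set does the following: it sets $R:=R+1$; if $R>\log_2\Delta$ it terminates; otherwise, if $\mathrm{MyDegree}>\Delta/2^R$, it declares itself a member of the cover set, sends a "drop" message to each of its remaining neighbors of non-zero degree, and takes no further part in later rounds; otherwise it waits for the next round. A node receiving a "drop" message deletes the sender from its neighbor list and decreases MyDegree by $1$. Space convention: space is the number of memory cells a node uses for its stored local data (neighbor list, $\Delta$, counters), where one cell holds one identifier or one integer; the message transmission queue is not counted. *)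

theory Defs
  imports
    "Graph_Theory.Graph_Theory"
    "HOL-Library.Landau_Symbols"
    "HOL-Library.Extended_Nat"
begin

text \<open>
  Networks are simple undirected graphs, represented as finite symmetric loop-free digraphs
  (locale \<^locale>\<open>pair_graph\<close>). The unique identifier of a node is its name, a natural number.
  The degree of a node is its out-degree, as each edge is a pair of opposite arcs.
\<close>

definition neighbours :: "nat pair_pre_digraph \<Rightarrow> nat \<Rightarrow> nat set" where
  "neighbours G v = {u. (v, u) \<in> parcs G}"

definition max_degree :: "nat pair_pre_digraph \<Rightarrow> nat" where
  "max_degree G = Max (out_degree (with_proj G) ` pverts G)"

datatype status = Active | InCover | Terminated

record node_state =
  ident :: nat
  nbrs :: "nat list"
  delta :: nat
  my_degree :: nat
  rnd :: nat
  status :: status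

type_synonym config = "nat \<Rightarrow> node_state"

definition init :: "nat pair_pre_digraph \<Rightarrow> config" where
  "init G v = \<lparr> ident = v, nbrs = sorted_list_of_set (neighbours G v), delta = max_degree G,
     my_degree = out_degree (with_proj G) v, rnd = 0, status = Active \<rparr>"

text \<open>
  The decision of a node at the start of a round. For the one-node network, where \<open>delta = 0\<close>,
  the library has \<^prop>\<open>log 2 0 = (0::real)\<close>; the node then terminates in round 1, exactly as with
  the convention that the logarithm of 0 is minus infinity.
\<close>

definition decide :: "node_state \<Rightarrow> node_state" where
  "decide s =
     (if status s \<noteq> Active then s
      else let r = rnd s + 1 in
        s\<lparr> rnd := r,
           status :=
             (if real r > log 2 (real (delta s)) then Terminated
              else if real (my_degree s) > real (delta s) / 2 ^ r then InCover
              else Active) \<rparr>)"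

definition joins :: "node_state \<Rightarrow> bool" where
  "joins s \<longleftrightarrow> status s = Active \<and> status (decide s) = InCover"

definition recipients :: "config \<Rightarrow> nat \<Rightarrow> nat set" where
  "recipients c v = {u \<in> set (nbrs (c v)). my_degree (c u) \<noteq> 0}"

definition drop_senders :: "nat pair_pre_digraph \<Rightarrow> config \<Rightarrow> nat \<Rightarrow> nat set" where
  "drop_senders G c v = {u \<in> pverts G. joins (c u) \<and> v \<in> recipients c u}"

definition receive_drop :: "nat \<Rightarrow> node_state \<Rightarrow> node_state" where
  "receive_drop u s = s\<lparr> nbrs := remove1 u (nbrs s), my_degree := my_degree s - 1 \<rparr>"

text \<open>
  One synchronous round: all decisions are based on the configuration at the start of the round,
  and all messages are delivered before the round ends. A node that joins the cover set in this
  round still processes the messages of this round. The order of processing is irrelevant; the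
  increasing order of senders is chosen.
\<close>

definition round_step :: "nat pair_pre_digraph \<Rightarrow> config \<Rightarrow> config" where
  "round_step G c v =
     (if status (c v) = Active
      then fold receive_drop (sorted_list_of_set (drop_senders G c v)) (decide (c v))
      else c v)"

definition run :: "nat pair_pre_digraph \<Rightarrow> nat \<Rightarrow> config" where
  "run G t = (round_step G ^^ t) (init G)"

text \<open>
  Memory contents of a node, one list entry per cell. The first entry encodes the status. Within a
  round the neighbour list only shrinks and the other cells are overwritten in place, so the
  states between rounds exhibit the peak space.
\<close>

definition status_code :: "status \<Rightarrow> nat" where
  "status_code st = (case st of Active \<Rightarrow> 0 | InCover \<Rightarrow> 1 | Terminated \<Rightarrow> 2)"

definition memory :: "node_state \<Rightarrow> nat list" where
  "memory s = [status_code (status s), ident s, delta s, my_degree s, rnd s] @ nbrs s"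

definition node_space :: "node_state \<Rightarrow> nat" where
  "node_space s = length (memory s)"

text \<open>
  The supremum of the space per node over all connected networks with \<open>n\<close> nodes, all their nodes
  and all times; it is taken in \<^typ>\<open>enat\<close> so that it is meaningful without a boundedness proof.
\<close>

definition worst_case_space :: "nat \<Rightarrow> enat" where
  "worst_case_space n =
     Sup {enat (node_space (run G t v)) | G t v.
            pair_graph G \<and> Digraph_Component.connected (with_proj G) \<and>
            card (pverts G) = n \<and> v \<in> pverts G}"

end

theory Submission
  imports Defs
begin

text \<open>Only \<open>receive_drop\<close> touches the neighbour list, and it only deletes, so the
  list never exceeds the degree, hence never \<open>n\<close> (\<open>length_nbrs_run\<close>,
  \<open>card_neighbours_le\<close>). The bound \<open>n + 5\<close> is uniform in network, node and
  time, so the supremum inherits it.\<close>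

text \<open>The neighbour list never grows, so the space of a node is at most its initial space, and
  initially the list has at most \<open>n\<close> entries next to the five fixed cells.\<close>

lemma length_nbrs_fold_receive_drop: "length (nbrs (fold receive_drop us s)) \<le> length (nbrs s)"
proof (induction us arbitrary: s)
  case (Cons u us)
  have "length (nbrs (fold receive_drop us (receive_drop u s))) \<le> length (nbrs (receive_drop u s))"
    by (rule Cons.IH)
  also have "\<dots> \<le> length (nbrs s)"
    by (simp add: receive_drop_def length_remove1)
  finally show ?case
    by simp
qed simp

lemma nbrs_decide [simp]: "nbrs (decide s) = nbrs s"
  by (simp add: decide_def Let_def)

lemma length_nbrs_round_step: "length (nbrs (round_step G c v)) \<le> length (nbrs (c v))"
  using length_nbrs_fold_receive_drop[of _ "decide (c v)"] by (simp add: round_step_def)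

lemma length_nbrs_run: "length (nbrs (run G t v)) \<le> card (neighbours G v)"
proof (induction t)
  case 0
  \<comment> \<open>Were the neighbourhood infinite, both sides would be 0, as
    \<open>sorted_list_of_set\<close> then gives \<open>[]\<close>.\<close>
  show ?case
    by (simp add: run_def init_def)
next
  case (Suc t)
  have "run G (Suc t) v = round_step G (run G t) v"
    by (simp add: run_def)
  with Suc show ?case
    using length_nbrs_round_step[of G "run G t" v] by simp
qed

lemma card_neighbours_le:
  assumes "pair_fin_digraph G"
  shows "card (neighbours G v) \<le> card (pverts G)"
proof (rule card_mono)
  interpret pair_fin_digraph G
    by (rule assms)
  show "finite (pverts G)"
    by (rule finite_verts)
  show "neighbours G v \<subseteq> pverts G"
    by (auto simp: neighbours_def dest: arc_snd_in_verts)
qed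

lemma node_space_run_le:
  assumes "pair_fin_digraph G"
  shows "node_space (run G t v) \<le> card (pverts G) + 5"
  using length_nbrs_run[of G t v] card_neighbours_le[OF assms, of v]
  by (simp add: node_space_def memory_def)

lemma worst_case_space_le: "worst_case_space n \<le> enat (n + 5)"
  unfolding worst_case_space_def
  by (rule Sup_least) (auto intro!: node_space_run_le pair_digraph.axioms(1) pair_graph.axioms(1))

theorem theorem3:
  shows "(\<forall>n. worst_case_space n \<noteq> \<infinity>) \<and>
    (\<lambda>n. real (the_enat (worst_case_space n))) \<in> O(\<lambda>n. real n)"
proof
  \<comment> \<open>Finiteness makes \<open>the_enat\<close> meaningful: its value at infinity is
    unspecified.\<close>
  show not_infinite: "\<forall>n. worst_case_space n \<noteq> \<infinity>"
  proof
    fix n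
    show "worst_case_space n \<noteq> \<infinity>"
      using worst_case_space_le[of n] by (cases "worst_case_space n") simp_all
  qed
  have "real (the_enat (worst_case_space n)) \<le> 6 * real n" if "n \<ge> 1" for n
  proof -
    have "the_enat (worst_case_space n) \<le> n + 5"
      using worst_case_space_le[of n] not_infinite by (cases "worst_case_space n") simp_all
    with that show ?thesis
      by linarith
  qed
  then show "(\<lambda>n. real (the_enat (worst_case_space n))) \<in> O(\<lambda>n. real n)"
    by (intro bigoI[where c = 6] eventually_sequentiallyI[of 1]) simp
qed

end
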